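(* For even $n\geq 2$, let $\mathrm{Dic}_n=\langle a,b,c\mid a^n=b^2=c^2=abc\rangle$ be the dicyclic group of order $4n$. Then Player 2 has a winning strategy for $\texttt{REL}(\mathrm{Dic}_n,\{a,b,c\})$.
   Context: Game $\texttt{REL}(G,S)$: $G$ is a finite group and $S$ a generating set with $e\notin S$. Two players alternate turns, Player 1 first, starting from the empty word $w_0$. On turn $n$ the current player chooses $s_n\in S\cup S^{-1}$, subject to $s_n\neq s_{n-1}^{-1}$ when $n>1$, and forms $w_n=w_{n-1}s_n$. If $w_n$ represents the same element of $G$ as some $w_k$ with $0\le k<n$, the player who formed $w_n$ wins. If a player has no legal move, that player loses. *)

theory Defs
  imports "HOL-Algebra.Generated_Groups"
begin

section \<open>The game\<close>

datatype player = Player1 | Player2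

text \<open>
  A position is the list \<open>[s\<^sub>1, \<dots>, s\<^sub>n]\<close> of the group elements chosen so far; the word \<open>w\<^sub>k\<close>
  is its prefix of length \<open>k\<close>.
\<close>

locale rel_game = group G for G (structure) +
  fixes S :: "'a set"
  assumes finite_carrier: "finite (carrier G)"
    and S_subset: "S \<subseteq> carrier G"
    and S_generates: "generate G S = carrier G"
    and one_notin_S: "\<one> \<notin> S"
begin

definition word_element :: "'a list \<Rightarrow> 'a" where
  "word_element p = foldl (\<otimes>) \<one> p"

definition legal_moves :: "'a list \<Rightarrow> 'a set" where
  "legal_moves p = {s \<in> S \<union> (\<lambda>x. inv x) ` S. p \<noteq> [] \<longrightarrow> s \<noteq> inv (last p)}"

definition relator_formed :: "'a list \<Rightarrow> bool" where
  "relator_formed p \<longleftrightarrow> (\<exists>k < length p. word_element p = word_element (take k p))"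

definition finished :: "'a list \<Rightarrow> bool" where
  "finished p \<longleftrightarrow> relator_formed p \<or> legal_moves p = {}"

inductive position :: "'a list \<Rightarrow> bool" where
  start: "position []"
| move: "position p \<Longrightarrow> \<not> finished p \<Longrightarrow> s \<in> legal_moves p \<Longrightarrow> position (p @ [s])"

definition to_move :: "'a list \<Rightarrow> player" where
  "to_move p = (if even (length p) then Player1 else Player2)"

text \<open>
  If a relator has just been formed, the winner is the player who made the last move, that is, the
  player who was to move at \<open>butlast p\<close>; otherwise the player to move is stuck and loses.
\<close>

definition wins :: "player \<Rightarrow> 'a list \<Rightarrow> bool" where
  "wins q p \<longleftrightarrow>
     (if relator_formed p then to_move (butlast p) = q
      else legal_moves p = {} \<and> to_move p \<noteq> q)"

definition strategy :: "player \<Rightarrow> ('a list \<Rightarrow> 'a) \<Rightarrow> bool" where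
  "strategy q \<sigma> \<longleftrightarrow>
     (\<forall>p. position p \<and> \<not> finished p \<and> to_move p = q \<longrightarrow> \<sigma> p \<in> legal_moves p)"

definition follows :: "player \<Rightarrow> ('a list \<Rightarrow> 'a) \<Rightarrow> 'a list \<Rightarrow> bool" where
  "follows q \<sigma> p \<longleftrightarrow>
     (\<forall>k < length p. to_move (take k p) = q \<longrightarrow> p ! k = \<sigma> (take k p))"

text \<open>
  Only finite plays need to be considered, because every play ends;
  see \<open>position_length_le\<close> below.
\<close>

definition winning_strategy :: "player \<Rightarrow> ('a list \<Rightarrow> 'a) \<Rightarrow> bool" where
  "winning_strategy q \<sigma> \<longleftrightarrow>
     strategy q \<sigma> \<and> (\<forall>p. position p \<and> finished p \<and> follows q \<sigma> p \<longrightarrow> wins q p)"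

definition has_winning_strategy :: "player \<Rightarrow> bool" where
  "has_winning_strategy q \<longleftrightarrow> (\<exists>\<sigma>. winning_strategy q \<sigma>)"

lemma legal_moves_closed: "legal_moves p \<subseteq> carrier G"
  using S_subset by (auto simp: legal_moves_def)

lemma word_element_snoc: "word_element (p @ [s]) = word_element p \<otimes> s"
  by (simp add: word_element_def)

lemma position_closed: "position p \<Longrightarrow> set p \<subseteq> carrier G"
proof (induction rule: position.induct)
  case (move p s)
  then show ?case using subsetD[OF legal_moves_closed[of p]] by simp
qed simp

lemma word_element_closed: "set p \<subseteq> carrier G \<Longrightarrow> word_element p \<in> carrier G"
proof (induction p rule: rev_induct)
  case Nil
  show ?case by (simp add: word_element_def)
qed (simp add: word_element_snoc)

lemma position_inj:
  assumes "position p" "\<not> relator_formed p"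
  shows "inj_on (\<lambda>k. word_element (take k p)) {..length p}"
  using assms
proof (induction rule: position.induct)
  case start
  show ?case by simp
next
  case (move p s)
  have "inj_on (\<lambda>k. word_element (take k p)) {..length p}"
    using move by (auto simp: finished_def)
  then have "inj_on (\<lambda>k. word_element (take k (p @ [s]))) {..length p}"
    by (rule inj_on_cong[THEN iffD1, rotated]) simp
  moreover have "word_element (p @ [s]) \<noteq> word_element (take k (p @ [s]))" if "k \<le> length p" for k
    using move.prems that unfolding relator_formed_def
    by (metis le_imp_less_Suc length_append_singleton)
  ultimately show ?case
    by (auto simp: atMost_Suc)
qed

lemma position_length_le:
  assumes "position p"
  shows "length p \<le> order G"
proof -
  have *: "length p < order G" if "position p" "\<not> relator_formed p" for p
  proof -
    have "word_element (take k p) \<in> carrier G" for k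
      using word_element_closed position_closed[OF that(1)] by (meson order_trans set_take_subset)
    then have "card ((\<lambda>k. word_element (take k p)) ` {..length p}) \<le> card (carrier G)"
      by (intro card_mono finite_carrier) auto
    then show ?thesis
      using card_image[OF position_inj[OF that]] by (simp add: order_def)
  qed
  from assms show ?thesis
  proof cases
    case (move p' s)
    then show ?thesis using *[of p'] by (auto simp: finished_def)
  qed simp
qed

end


section \<open>Groups given by a presentation\<close>

text \<open>
  A letter \<open>(x, True)\<close> stands for the generator \<open>x\<close> and \<open>(x, False)\<close> for its formal inverse.
  A presentation is a set \<open>R\<close> of pairs of words, the pair \<open>(r, s)\<close> being the relation \<open>r = s\<close>;
  the presented group consists of all words modulo the congruence generated by \<open>R\<close> and free
  cancellation.
\<close>

type_synonym 'g word = "('g \<times> bool) list"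

inductive pres_eq :: "('g word \<times> 'g word) set \<Rightarrow> 'g word \<Rightarrow> 'g word \<Rightarrow> bool"
  for R :: "('g word \<times> 'g word) set" where
  refl: "pres_eq R u u"
| sym: "pres_eq R u v \<Longrightarrow> pres_eq R v u"
| trans: "pres_eq R u v \<Longrightarrow> pres_eq R v w \<Longrightarrow> pres_eq R u w"
| cancel: "pres_eq R (u @ [(x, e), (x, \<not> e)] @ v) (u @ v)"
| relation: "(r, s) \<in> R \<Longrightarrow> pres_eq R (u @ r @ v) (u @ s @ v)"

definition word_class :: "('g word \<times> 'g word) set \<Rightarrow> 'g word \<Rightarrow> 'g word set" where
  "word_class R u = {v. pres_eq R u v}"

definition presented_group :: "('g word \<times> 'g word) set \<Rightarrow> 'g word set monoid" where
  "presented_group R =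
     \<lparr>carrier = range (word_class R),
      mult = (\<lambda>X Y. \<Union>u\<in>X. \<Union>v\<in>Y. word_class R (u @ v)),
      one = word_class R []\<rparr>"

definition pres_gen :: "('g word \<times> 'g word) set \<Rightarrow> 'g \<Rightarrow> 'g word set" where
  "pres_gen R x = word_class R [(x, True)]"

lemma mem_word_class: "v \<in> word_class R u \<longleftrightarrow> pres_eq R u v"
  by (simp add: word_class_def)

lemma word_class_eq_iff: "word_class R u = word_class R v \<longleftrightarrow> pres_eq R u v"
proof
  assume "word_class R u = word_class R v"
  then have "v \<in> word_class R u"
    by (simp only: mem_word_class pres_eq.refl)
  then show "pres_eq R u v"
    by (simp only: mem_word_class)
next
  assume uv: "pres_eq R u v"
  show "word_class R u = word_class R v"
  proof (rule Set.set_eqI)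
    fix w
    show "w \<in> word_class R u \<longleftrightarrow> w \<in> word_class R v"
      unfolding mem_word_class
      using pres_eq.trans[OF uv, of w] pres_eq.trans[OF pres_eq.sym[OF uv], of w] by argo
  qed
qed

lemma pres_eq_context: "pres_eq R u v \<Longrightarrow> pres_eq R (x @ u @ y) (x @ v @ y)"
proof (induction rule: pres_eq.induct)
  case (refl u)
  show ?case by (rule pres_eq.refl)
next
  case (sym u v)
  show ?case by (rule pres_eq.sym[OF sym.IH])
next
  case (trans u v w)
  show ?case by (rule pres_eq.trans[OF trans.IH])
next
  case (cancel u z e v)
  show ?case using pres_eq.cancel[of R "x @ u" z e "v @ y"] by simp
next
  case (relation r s u v)
  then show ?case using pres_eq.relation[of r s R "x @ u" "v @ y"] by simp
qed

lemma pres_eq_append: "pres_eq R u u' \<Longrightarrow> pres_eq R v v' \<Longrightarrow> pres_eq R (u @ v) (u' @ v')"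
  using pres_eq_context[of R u u' "[]" v] pres_eq_context[of R v v' u' "[]"]
    pres_eq.trans[of R "u @ v" "u' @ v" "u' @ v'"] by simp

lemma presented_group_mult:
  "word_class R u \<otimes>\<^bsub>presented_group R\<^esub> word_class R v = word_class R (u @ v)"
proof -
  have "word_class R (u' @ v') = word_class R (u @ v)"
    if "u' \<in> word_class R u" "v' \<in> word_class R v" for u' v'
  proof -
    have "pres_eq R u u'" "pres_eq R v v'"
      using that by (simp_all only: mem_word_class)
    then show ?thesis
      unfolding word_class_eq_iff by (intro pres_eq.sym[OF pres_eq_append])
  qed
  then have "(\<Union>u'\<in>word_class R u. \<Union>v'\<in>word_class R v. word_class R (u' @ v')) =
      (\<Union>u'\<in>word_class R u. \<Union>v'\<in>word_class R v. word_class R (u @ v))"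
    by simp
  moreover have "word_class R u \<noteq> {}" "word_class R v \<noteq> {}"
    using pres_eq.refl[of R u] pres_eq.refl[of R v] unfolding mem_word_class[symmetric] by blast+
  ultimately show ?thesis
    by (simp add: presented_group_def)
qed

lemma presented_group_one: "\<one>\<^bsub>presented_group R\<^esub> = word_class R []"
  by (simp add: presented_group_def)

lemma presented_group_carrier: "carrier (presented_group R) = range (word_class R)"
  by (simp add: presented_group_def)

lemma pres_eq_inverse:
  "pres_eq R (rev (map (\<lambda>(x, e). (x, \<not> e)) u) @ u) []"
proof (induction u)
  case (Cons l u)
  obtain x e where l: "l = (x, e)" by (cases l)
  show ?case
    using pres_eq.cancel[of R "rev (map (\<lambda>(x, e). (x, \<not> e)) u)" x "\<not> e" u]
    by (simp add: l) (rule pres_eq.trans[OF _ Cons.IH])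
qed (auto intro: pres_eq.refl)

lemma word_class_closed [simp]: "word_class R u \<in> carrier (presented_group R)"
  by (simp add: presented_group_carrier)

lemma presented_group_is_group: "group (presented_group R)"
proof (rule groupI)
  let ?G = "presented_group R"
  show "\<one>\<^bsub>?G\<^esub> \<in> carrier ?G"
    by (simp add: presented_group_one)
  fix x assume "x \<in> carrier ?G"
  then obtain u where u: "x = word_class R u" by (auto simp: presented_group_carrier)
  show "\<one>\<^bsub>?G\<^esub> \<otimes>\<^bsub>?G\<^esub> x = x"
    by (simp add: u presented_group_one presented_group_mult)
  have "word_class R (rev (map (\<lambda>(x, e). (x, \<not> e)) u)) \<otimes>\<^bsub>?G\<^esub> x = \<one>\<^bsub>?G\<^esub>"
    unfolding u presented_group_mult presented_group_one word_class_eq_iff by (rule pres_eq_inverse)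
  then show "\<exists>y\<in>carrier ?G. y \<otimes>\<^bsub>?G\<^esub> x = \<one>\<^bsub>?G\<^esub>"
    using word_class_closed by blast
  fix y assume "y \<in> carrier ?G"
  then obtain v where v: "y = word_class R v" by (auto simp: presented_group_carrier)
  show "x \<otimes>\<^bsub>?G\<^esub> y \<in> carrier ?G"
    by (simp add: u v presented_group_mult)
  fix z assume "z \<in> carrier ?G"
  then obtain w where w: "z = word_class R w" by (auto simp: presented_group_carrier)
  show "x \<otimes>\<^bsub>?G\<^esub> y \<otimes>\<^bsub>?G\<^esub> z = x \<otimes>\<^bsub>?G\<^esub> (y \<otimes>\<^bsub>?G\<^esub> z)"
    by (simp add: u v w presented_group_mult)
qed

lemma presented_group_relation: "(r, s) \<in> R \<Longrightarrow> word_class R r = word_class R s"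
  using pres_eq.relation[of r s R "[]" "[]"] by (simp add: word_class_eq_iff)

lemma inv_pres_gen: "inv\<^bsub>presented_group R\<^esub> (pres_gen R x) = word_class R [(x, False)]"
proof (rule group.inv_equality[OF presented_group_is_group])
  show "word_class R [(x, False)] \<otimes>\<^bsub>presented_group R\<^esub> pres_gen R x = \<one>\<^bsub>presented_group R\<^esub>"
    using pres_eq.cancel[of R "[]" x False "[]"]
    by (simp add: pres_gen_def presented_group_mult presented_group_one word_class_eq_iff)
qed (simp_all add: pres_gen_def)

lemma generate_pres_gen: "generate (presented_group R) (range (pres_gen R)) = carrier (presented_group R)"
proof -
  interpret group "presented_group R" by (rule presented_group_is_group)
  have "word_class R u \<in> generate (presented_group R) (range (pres_gen R))" for u
  proof (induction u)
    case Nil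
    show ?case using generate.one[of "presented_group R"] by (simp add: presented_group_one)
  next
    case (Cons l u)
    obtain x e where l: "l = (x, e)" by (cases l)
    have "word_class R [l] \<in> generate (presented_group R) (range (pres_gen R))"
    proof (cases e)
      case True
      then show ?thesis using generate.incl[of "pres_gen R x" "range (pres_gen R)"]
        by (simp add: l pres_gen_def)
    next
      case False
      then show ?thesis
        using generate.inv[of "pres_gen R x" "range (pres_gen R)" "presented_group R"]
        by (simp add: l inv_pres_gen)
    qed
    from generate.eng[OF this Cons.IH] show ?case by (simp add: presented_group_mult)
  qed
  moreover have "range (pres_gen R) \<subseteq> carrier (presented_group R)"
    by (auto simp: pres_gen_def)
  ultimately show ?thesis
    using generate_incl[of "range (pres_gen R)"] unfolding presented_group_carrier by blast
qed


section \<open>The dicyclic groups\<close>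

datatype dic_letter = Gen_a | Gen_b | Gen_c

definition dic_relations :: "nat \<Rightarrow> (dic_letter word \<times> dic_letter word) set" where
  "dic_relations n =
     (let a = (Gen_a, True); b = (Gen_b, True); c = (Gen_c, True) in
       {(replicate n a, [b, b]), ([b, b], [c, c]), ([c, c], [a, b, c])})"

definition Dic :: "nat \<Rightarrow> dic_letter word set monoid" where
  "Dic n = presented_group (dic_relations n)"

definition dic_a :: "nat \<Rightarrow> dic_letter word set" where "dic_a n = pres_gen (dic_relations n) Gen_a"
definition dic_b :: "nat \<Rightarrow> dic_letter word set" where "dic_b n = pres_gen (dic_relations n) Gen_b"
definition dic_c :: "nat \<Rightarrow> dic_letter word set" where "dic_c n = pres_gen (dic_relations n) Gen_c"

text \<open>
  That the presentation yields a group of order \<open>4 * n\<close> in which the game can be played is proved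
  below. The lower bound comes from letting words act from the right on the normal forms
  \<open>a\<^sup>i b\<^sup>j\<close> (\<open>0 \<le> i < 2 * n\<close>, \<open>j \<le> 1\<close>), encoded as pairs \<open>(i, j)\<close>.
\<close>

fun dic_act :: "nat \<Rightarrow> int \<times> bool \<Rightarrow> dic_letter \<times> bool \<Rightarrow> int \<times> bool" where
  "dic_act n (i, j) (Gen_a, True) = ((if j then i - 1 else i + 1) mod (2 * int n), j)"
| "dic_act n (i, j) (Gen_a, False) = ((if j then i + 1 else i - 1) mod (2 * int n), j)"
| "dic_act n (i, j) (Gen_b, True) = ((if j then i + int n else i) mod (2 * int n), \<not> j)"
| "dic_act n (i, j) (Gen_b, False) = ((if j then i else i + int n) mod (2 * int n), \<not> j)"
| "dic_act n (i, j) (Gen_c, True) = ((if j then i + (int n - 1) else i + 1) mod (2 * int n), \<not> j)"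
| "dic_act n (i, j) (Gen_c, False) = ((if j then i - 1 else i + (int n + 1)) mod (2 * int n), \<not> j)"

definition dic_states :: "nat \<Rightarrow> (int \<times> bool) set" where
  "dic_states n = {0..<2 * int n} \<times> UNIV"

lemma dic_act_closed: "n > 0 \<Longrightarrow> dic_act n s l \<in> dic_states n"
  by (cases "(n, s, l)" rule: dic_act.cases) (auto simp: dic_states_def)

lemma dic_act_list_closed:
  "n > 0 \<Longrightarrow> s \<in> dic_states n \<Longrightarrow> foldl (dic_act n) s u \<in> dic_states n"
  by (induction u arbitrary: s) (simp_all add: dic_act_closed del: split_paired_All)

lemma add_two_mod: "(x + int n + int n) mod (2 * int n) = x mod (2 * int n)"
  by (metis add.assoc mod_add_self2 mult_2)

lemma dic_act_cancel:
  assumes "s \<in> dic_states n"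
  shows "dic_act n (dic_act n s (x, e)) (x, \<not> e) = s"
proof -
  obtain i j where s: "s = (i, j)" by (cases s)
  have i: "i mod (2 * int n) = i" using assms by (auto simp: s dic_states_def)
  show ?thesis
    using i add_two_mod[of i n] add_two_mod[of "i + 1" n] add_two_mod[of "i - 1" n]
    by (cases x; cases e; cases j; simp add: s mod_simps; simp add: algebra_simps)
qed

lemma dic_act_replicate:
  assumes "s \<in> dic_states n"
  shows "foldl (dic_act n) s (replicate k (Gen_a, True)) =
    ((if snd s then fst s - int k else fst s + int k) mod (2 * int n), snd s)"
proof (induction k)
  case 0
  show ?case using assms by (auto simp: dic_states_def)
next
  case (Suc k)
  have "foldl (dic_act n) s (replicate (Suc k) (Gen_a, True)) =
      dic_act n (foldl (dic_act n) s (replicate k (Gen_a, True))) (Gen_a, True)"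
    by (simp flip: replicate_append_same)
  then show ?case unfolding Suc.IH by (simp add: mod_simps algebra_simps)
qed

lemma dic_act_relation:
  assumes "(r, r') \<in> dic_relations n" "s \<in> dic_states n"
  shows "foldl (dic_act n) s r = foldl (dic_act n) s r'"
proof -
  obtain i j where s: "s = (i, j)" by (cases s)
  have "(i - int n) mod (2 * int n) = (i + int n) mod (2 * int n)"
    using add_two_mod[of "i - int n" n] by simp
  then show ?thesis
    using assms(1) dic_act_replicate[OF assms(2), of n] unfolding dic_relations_def Let_def
    by (cases j) (auto simp: s mod_simps, (simp_all add: algebra_simps)?)
qed

lemma dic_act_pres_eq:
  assumes "pres_eq (dic_relations n) u v" "n > 0" "s \<in> dic_states n"
  shows "foldl (dic_act n) s u = foldl (dic_act n) s v"
  using assms(1,3)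
proof (induction arbitrary: s rule: pres_eq.induct)
  case (cancel u x e v)
  then show ?case using dic_act_cancel[OF dic_act_list_closed[OF assms(2)]] by simp
next
  case (relation r r' u v)
  then show ?case using dic_act_relation[OF _ dic_act_list_closed[OF assms(2)]] by simp
qed simp_all

definition dic_normal_form :: "nat \<Rightarrow> int \<times> bool \<Rightarrow> dic_letter word set" where
  "dic_normal_form n s =
     word_class (dic_relations n) (replicate (nat (fst s)) (Gen_a, True) @ (if snd s then [(Gen_b, True)] else []))"

lemma dic_act_normal_form:
  assumes "n > 0" "s \<in> dic_states n"
  shows "foldl (dic_act n) (0, False) (replicate (nat (fst s)) (Gen_a, True) @ (if snd s then [(Gen_b, True)] else [])) = s"
  using assms dic_act_replicate[of "(0, False)" n "nat (fst s)"]
  by (cases s) (auto simp: dic_states_def)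

lemma inj_on_dic_normal_form:
  assumes "n > 0" shows "inj_on (dic_normal_form n) (dic_states n)"
proof (rule inj_onI)
  fix s t assume st: "s \<in> dic_states n" "t \<in> dic_states n" "dic_normal_form n s = dic_normal_form n t"
  have "(0, False) \<in> dic_states n" using assms by (simp add: dic_states_def)
  then show "s = t"
    using dic_act_pres_eq[OF st(3)[unfolded dic_normal_form_def word_class_eq_iff] assms, of "(0, False)"]
    by (simp only: dic_act_normal_form[OF assms] st(1,2))
qed

lemma dic_generators_closed: "{dic_a n, dic_b n, dic_c n} \<subseteq> carrier (Dic n)"
  by (simp add: dic_a_def dic_b_def dic_c_def pres_gen_def Dic_def)

lemma dic_group: "group (Dic n)"
  unfolding Dic_def by (rule presented_group_is_group)

lemma dic_generate: "generate (Dic n) {dic_a n, dic_b n, dic_c n} = carrier (Dic n)"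
proof -
  have "UNIV = {Gen_a, Gen_b, Gen_c}" using dic_letter.exhaust by auto
  then have "range (pres_gen (dic_relations n)) = {dic_a n, dic_b n, dic_c n}"
    unfolding dic_a_def dic_b_def dic_c_def by (metis image_empty image_insert)
  then show ?thesis using generate_pres_gen[of "dic_relations n"] by (simp add: Dic_def)
qed

lemma dic_relations_mem:
  "(replicate n (Gen_a, True), [(Gen_b, True), (Gen_b, True)]) \<in> dic_relations n"
  "([(Gen_b, True), (Gen_b, True)], [(Gen_c, True), (Gen_c, True)]) \<in> dic_relations n"
  "([(Gen_c, True), (Gen_c, True)], [(Gen_a, True), (Gen_b, True), (Gen_c, True)]) \<in> dic_relations n"
  by (simp_all add: dic_relations_def Let_def)

lemma dic_relations_hold:
  fixes n :: nat
  defines "G \<equiv> Dic n"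
  shows "dic_a n [^]\<^bsub>G\<^esub> n = dic_b n \<otimes>\<^bsub>G\<^esub> dic_b n"
    and "dic_b n \<otimes>\<^bsub>G\<^esub> dic_b n = dic_c n \<otimes>\<^bsub>G\<^esub> dic_c n"
    and "dic_c n \<otimes>\<^bsub>G\<^esub> dic_c n = dic_a n \<otimes>\<^bsub>G\<^esub> dic_b n \<otimes>\<^bsub>G\<^esub> dic_c n"
proof -
  have "dic_a n [^]\<^bsub>G\<^esub> k = word_class (dic_relations n) (replicate k (Gen_a, True))" for k :: nat
    by (induction k)
      (simp_all add: G_def Dic_def dic_a_def pres_gen_def presented_group_one presented_group_mult
        replicate_append_same)
  then show "dic_a n [^]\<^bsub>G\<^esub> n = dic_b n \<otimes>\<^bsub>G\<^esub> dic_b n"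
    using presented_group_relation[OF dic_relations_mem(1)]
    by (simp add: G_def Dic_def dic_b_def pres_gen_def presented_group_mult)
  show "dic_b n \<otimes>\<^bsub>G\<^esub> dic_b n = dic_c n \<otimes>\<^bsub>G\<^esub> dic_c n"
    using presented_group_relation[OF dic_relations_mem(2)]
    by (simp add: G_def Dic_def dic_b_def dic_c_def pres_gen_def presented_group_mult)
  show "dic_c n \<otimes>\<^bsub>G\<^esub> dic_c n = dic_a n \<otimes>\<^bsub>G\<^esub> dic_b n \<otimes>\<^bsub>G\<^esub> dic_c n"
    using presented_group_relation[OF dic_relations_mem(3)]
    by (simp add: G_def Dic_def dic_a_def dic_b_def dic_c_def pres_gen_def presented_group_mult)
qed

lemma (in group) dicyclic_normal_forms:
  assumes n: "n > 0" and abc: "a \<in> carrier G" "b \<in> carrier G" "c \<in> carrier G"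
    and ab: "a [^] n = b \<otimes> b" and bc: "b \<otimes> b = c \<otimes> c" and ca: "c \<otimes> c = a \<otimes> b \<otimes> c"
  shows "generate G {a, b, c} \<subseteq>
    (\<lambda>(i, j). a [^] nat i \<otimes> (if j then b else \<one>)) ` dic_states n"
proof -
  have c: "c = a \<otimes> b"
    using ca abc by (metis m_closed right_cancel)
  have "b \<otimes> b = a \<otimes> b \<otimes> a \<otimes> b"
    using bc abc by (simp add: c m_assoc)
  then have aba: "a \<otimes> b \<otimes> a = b"
    using abc by (metis m_closed right_cancel)
  have ba: "b \<otimes> a = inv a \<otimes> b"
    using aba abc by (metis inv_solve_left m_assoc m_closed)
  have bai: "b \<otimes> inv a = a \<otimes> b"
    using aba abc by (metis inv_solve_right' m_closed)
  have b_pow: "b \<otimes> a [^] k = inv (a [^] k) \<otimes> b" for k :: nat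
  proof (induction k)
    case (Suc k)
    have "b \<otimes> a [^] Suc k = b \<otimes> a [^] k \<otimes> a"
      using abc by (simp add: m_assoc)
    also have "\<dots> = inv (a [^] k) \<otimes> (b \<otimes> a)"
      using abc by (simp add: Suc.IH m_assoc)
    also have "\<dots> = inv (a [^] k) \<otimes> inv a \<otimes> b"
      using abc by (simp add: ba m_assoc)
    also have "\<dots> = inv (a [^] Suc k) \<otimes> b"
      using abc by (metis inv_mult_group nat_pow_Suc2 nat_pow_closed)
    finally show ?case .
  qed (use abc in simp)
  have inv_an: "inv (a [^] n) = a [^] n"
  proof -
    have "inv (a [^] n) \<otimes> b = a [^] n \<otimes> b"
      using b_pow[of n] abc unfolding ab by (simp add: m_assoc)
    then show ?thesis using abc by (metis inv_closed nat_pow_closed right_cancel)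
  qed
  have order: "a [^] (2 * int n) = \<one>"
  proof -
    have "a [^] (2 * n) = a [^] n \<otimes> a [^] n"
      using abc by (simp add: nat_pow_mult mult_2)
    also have "\<dots> = \<one>"
      using inv_an abc by (metis l_inv nat_pow_closed)
    finally show ?thesis using int_pow_int[of G a "2 * n"] by simp
  qed
  have mod: "a [^] (i mod (2 * int n)) = a [^] i" for i
  proof -
    have "a [^] i = a [^] (2 * int n * (i div (2 * int n)) + i mod (2 * int n))"
      by simp
    also have "\<dots> = (a [^] (2 * int n)) [^] (i div (2 * int n)) \<otimes> a [^] (i mod (2 * int n))"
      using abc by (simp only: int_pow_mult int_pow_pow)
    also have "\<dots> = a [^] (i mod (2 * int n))"
      unfolding order using abc by simp
    finally show ?thesis by simp
  qed
  define N where "N = (\<lambda>i j. a [^] (i :: int) \<otimes> (if j then b else \<one>))"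
  have N_in: "N i j \<in> (\<lambda>(i, j). a [^] nat i \<otimes> (if j then b else \<one>)) ` dic_states n" for i j
  proof (rule image_eqI)
    show "(i mod (2 * int n), j) \<in> dic_states n" using n by (simp add: dic_states_def)
    have "a [^] nat (i mod (2 * int n)) = a [^] i"
      using mod[of i] n int_pow_int[of G a "nat (i mod (2 * int n))"] by simp
    then show "N i j = (case (i mod (2 * int n), j) of (i, j) \<Rightarrow> a [^] nat i \<otimes> (if j then b else \<one>))"
      by (simp add: N_def)
  qed
  have Na: "\<exists>i' j'. N i j \<otimes> a = N i' j'" for i j
  proof (cases j)
    case True
    have "N i j \<otimes> a = a [^] i \<otimes> a [^] (-1 :: int) \<otimes> b"
      using True abc by (simp add: N_def m_assoc ba int_pow_neg)
    then have "N i j \<otimes> a = N (i + -1) True"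
      using abc by (simp only: N_def int_pow_mult if_True)
    then show ?thesis by blast
  next
    case False
    have "N i j \<otimes> a = N (i + 1) False"
      using False abc by (simp add: N_def int_pow_mult)
    then show ?thesis by blast
  qed
  have Nai: "\<exists>i' j'. N i j \<otimes> inv a = N i' j'" for i j
  proof (cases j)
    case True
    have "N i j \<otimes> inv a = a [^] i \<otimes> a [^] (1 :: int) \<otimes> b"
      using True abc by (simp add: N_def m_assoc bai)
    then have "N i j \<otimes> inv a = N (i + 1) True"
      using abc by (simp only: N_def int_pow_mult if_True)
    then show ?thesis by blast
  next
    case False
    have "N i j \<otimes> inv a = a [^] i \<otimes> a [^] (-1 :: int) \<otimes> \<one>"
      using False abc by (simp add: N_def int_pow_neg)
    then have "N i j \<otimes> inv a = N (i + -1) False"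
      using abc by (simp only: N_def int_pow_mult if_False)
    then show ?thesis by blast
  qed
  have Nb: "\<exists>i' j'. N i j \<otimes> b = N i' j'" for i j
  proof (cases j)
    case True
    have "N i j \<otimes> b = a [^] i \<otimes> a [^] (int n) \<otimes> \<one>"
      using True abc ab by (simp add: N_def m_assoc int_pow_int)
    then have "N i j \<otimes> b = N (i + int n) False"
      using abc by (simp only: N_def int_pow_mult if_False)
    then show ?thesis by blast
  next
    case False
    then have "N i j \<otimes> b = N i True"
      using abc by (simp add: N_def)
    then show ?thesis by blast
  qed
  have Nbi: "\<exists>i' j'. N i j \<otimes> inv b = N i' j'" for i j
  proof (cases j)
    case True
    then have "N i j \<otimes> inv b = N i False"
      using abc by (simp add: N_def m_assoc)
    then show ?thesis by blast
  next
    case False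
    have "inv b = inv (b \<otimes> b) \<otimes> b"
      using abc by (simp add: inv_mult_group m_assoc)
    then have "inv b = a [^] int n \<otimes> b"
      using inv_an ab by (simp add: int_pow_int)
    then have "N i j \<otimes> inv b = a [^] i \<otimes> a [^] int n \<otimes> b"
      using False abc by (simp add: N_def m_assoc)
    then have "N i j \<otimes> inv b = N (i + int n) True"
      using abc by (simp only: N_def int_pow_mult if_True)
    then show ?thesis by blast
  qed
  have N_closed: "N i j \<in> carrier G" for i j
    using abc by (simp add: N_def)
  have Nc: "\<exists>i' j'. N i j \<otimes> c = N i' j'" for i j
    using Na[of i j] Nb N_closed abc by (metis c m_assoc)
  have Nci: "\<exists>i' j'. N i j \<otimes> inv c = N i' j'" for i j
  proof -
    have "N i j \<otimes> inv c = N i j \<otimes> inv b \<otimes> inv a"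
      using N_closed abc by (simp add: c inv_mult_group m_assoc)
    then show ?thesis using Nbi[of i j] Nai by metis
  qed
  have step: "\<exists>i' j'. N i j \<otimes> x = N i' j'" if "x \<in> generate G {a, b, c}" for x i j
    using that
  proof (induction arbitrary: i j rule: generate.induct)
    case one
    show ?case using N_closed by auto
  next
    case (incl h)
    then show ?case using Na Nb Nc by auto
  next
    case (inv h)
    then show ?case using Nai Nbi Nci by auto
  next
    case (eng h1 h2)
    have "h1 \<in> carrier G" "h2 \<in> carrier G"
      using eng.hyps generate_in_carrier[of "{a, b, c}"] abc by auto
    then have "N i j \<otimes> (h1 \<otimes> h2) = N i j \<otimes> h1 \<otimes> h2"
      using N_closed by (simp add: m_assoc)
    then show ?case using eng.IH by metis
  qed
  show ?thesis
  proof
    fix x assume x: "x \<in> generate G {a, b, c}"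
    then have "x \<in> carrier G" using generate_in_carrier[of "{a, b, c}"] abc by auto
    then have "x = N 0 False \<otimes> x" by (simp add: N_def)
    then show "x \<in> (\<lambda>(i, j). a [^] nat i \<otimes> (if j then b else \<one>)) ` dic_states n"
      using step[OF x, of 0 False] N_in by metis
  qed
qed

lemma finite_dic_states: "finite (dic_states n)"
  and card_dic_states: "card (dic_states n) = 4 * n"
  by (simp_all add: dic_states_def card_cartesian_product)

lemma dic_finite_order:
  assumes "n > 0"
  shows "finite (carrier (Dic n))" and "order (Dic n) = 4 * n"
proof -
  interpret group "Dic n" by (rule dic_group)
  have closed: "dic_a n \<in> carrier (Dic n)" "dic_b n \<in> carrier (Dic n)" "dic_c n \<in> carrier (Dic n)"
    using dic_generators_closed by auto
  have sub: "carrier (Dic n) \<subseteq>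
      (\<lambda>(i, j). dic_a n [^]\<^bsub>Dic n\<^esub> nat i \<otimes>\<^bsub>Dic n\<^esub> (if j then dic_b n else \<one>\<^bsub>Dic n\<^esub>)) ` dic_states n"
    using dicyclic_normal_forms[OF assms closed dic_relations_hold] unfolding dic_generate .
  show fin: "finite (carrier (Dic n))"
    using finite_subset[OF sub] finite_dic_states by blast
  have "card (carrier (Dic n)) \<le> card (dic_states n)"
    using surj_card_le[OF finite_dic_states sub] .
  moreover have "card (dic_states n) \<le> card (carrier (Dic n))"
  proof (rule card_inj_on_le[OF inj_on_dic_normal_form[OF assms] _ fin])
    show "dic_normal_form n ` dic_states n \<subseteq> carrier (Dic n)"
      by (auto simp: dic_normal_form_def Dic_def)
  qed
  ultimately show "order (Dic n) = 4 * n"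
    by (simp add: order_def card_dic_states)
qed

lemma dic_rel_game:
  assumes "n > 0"
  shows "rel_game (Dic n) {dic_a n, dic_b n, dic_c n}"
proof -
  interpret group "Dic n" by (rule dic_group)
  have "(0, False) \<in> dic_states n" using assms by (simp add: dic_states_def)
  have *: "pres_gen (dic_relations n) x \<noteq> \<one>\<^bsub>Dic n\<^esub>" for x
  proof
    assume "pres_gen (dic_relations n) x = \<one>\<^bsub>Dic n\<^esub>"
    then have "pres_eq (dic_relations n) [(x, True)] []"
      by (simp add: Dic_def presented_group_one pres_gen_def word_class_eq_iff)
    from dic_act_pres_eq[OF this assms \<open>(0, False) \<in> dic_states n\<close>]
    show False using assms by (cases x) auto
  qed
  show ?thesis
  proof
    show "\<one>\<^bsub>Dic n\<^esub> \<notin> {dic_a n, dic_b n, dic_c n}"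
      using *[of Gen_a] *[of Gen_b] *[of Gen_c] by (simp add: dic_a_def dic_b_def dic_c_def)
  qed (use dic_finite_order(1)[OF assms] dic_generators_closed dic_generate in auto)
qed

end

theory Submission
  imports Defs "HOL-Algebra.Multiplicative_Group"
begin

text \<open>
  The game traces a path in the Cayley graph, and whoever first leaves it no longer induced loses,
  since the opponent can step back onto a visited vertex. Player 2 closes a relator when possible and
  otherwise repeats the letter just played. Repeating \<open>a\<^sup>\<plusminus>\<^sup>1\<close> keeps the length of every arc in \<open>\<langle>a\<rangle>\<close>
  even; repeating \<open>b\<^sup>\<plusminus>\<^sup>1\<close> or \<open>c\<^sup>\<plusminus>\<^sup>1\<close> moves from \<open>a\<^sup>i\<close> to \<open>a\<^sup>i\<^sup>+\<^sup>n\<close>. The middle vertex of such a crossing, which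
  is adjacent to both ends, blocks one of the two directions along \<open>\<langle>a\<rangle>\<close>, so that the path can cross
  at most twice and all its arcs are determined by their ends. As \<open>n\<close> is even, it is always Player 1
  who runs out of room.
\<close>

section \<open>From legal plays to walks in the Cayley graph\<close>

text \<open>
  \<open>V\<close> is the set of visited vertices, \<open>x\<close> the current one and \<open>u\<close> its predecessor on the path; the
  player to move is the one who is going to lose.
\<close>

inductive second_wins :: "('a \<Rightarrow> 'a \<Rightarrow> bool) \<Rightarrow> 'a set \<Rightarrow> 'a \<Rightarrow> 'a \<Rightarrow> bool"
  for adj :: "'a \<Rightarrow> 'a \<Rightarrow> bool" where
  second_winsI: "(\<And>y. adj x y \<Longrightarrow> y \<noteq> u \<Longrightarrow>
      y \<notin> V \<and> (\<exists>z. adj y z \<and> z \<noteq> x \<and> (z \<in> V \<or> second_wins adj (insert z (insert y V)) y z)))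
    \<Longrightarrow> second_wins adj V u x"

context rel_game
begin

text \<open>The edges of the undirected Cayley graph. With \<open>x\<close> in the carrier,
  \<open>y\<close> lies there too, which makes the relation symmetric.\<close>

definition adjacent :: "'a \<Rightarrow> 'a \<Rightarrow> bool" where
  "adjacent x y \<longleftrightarrow> x \<in> carrier G \<and> (\<exists>s \<in> S \<union> (\<lambda>x. inv x) ` S. y = x \<otimes> s)"

definition visited :: "'a list \<Rightarrow> 'a set" where
  "visited p = (\<lambda>k. word_element (take k p)) ` {..length p}"

lemma visited_Nil: "visited [] = {\<one>}"
  by (simp add: visited_def word_element_def)

lemma visited_snoc: "visited (p @ [s]) = insert (word_element (p @ [s])) (visited p)"
proof -
  have "{..length (p @ [s])} = insert (length (p @ [s])) {..length p}"
    by auto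
  then show ?thesis
    by (auto simp: visited_def)
qed

lemma relator_formed_snoc: "relator_formed (p @ [s]) \<longleftrightarrow> word_element (p @ [s]) \<in> visited p"
  by (auto simp: relator_formed_def visited_def less_Suc_eq_le)

lemma moves_closed: "s \<in> S \<union> (\<lambda>x. inv x) ` S \<Longrightarrow> s \<in> carrier G"
  using S_subset by auto

lemma adjacent_sym:
  assumes "adjacent x y"
  shows "adjacent y x"
proof -
  obtain s where s: "s \<in> S \<union> (\<lambda>x. inv x) ` S" "y = x \<otimes> s" "x \<in> carrier G"
    using assms by (auto simp: adjacent_def)
  have c: "s \<in> carrier G" by (rule moves_closed[OF s(1)])
  have "inv s \<in> S \<union> (\<lambda>x. inv x) ` S"
    using s(1) S_subset by (auto simp: subset_iff)
  moreover have "x = y \<otimes> inv s"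
    unfolding s(2) using s(3) c by (simp add: m_assoc)
  moreover have "y \<in> carrier G"
    unfolding s(2) using s(3) c by simp
  ultimately show ?thesis unfolding adjacent_def by (intro conjI bexI)
qed

lemma not_adjacent_self: "\<not> adjacent x x"
  using one_notin_S S_subset by (auto simp: adjacent_def)

text \<open>
  For the empty position \<open>butlast\<close> returns the identity itself, which no move can reach,
  so the condition on \<open>butlast\<close> is then vacuous, as it should be.
\<close>

lemma legal_moves_iff:
  assumes "set p \<subseteq> carrier G"
  shows "s \<in> legal_moves p \<longleftrightarrow> s \<in> S \<union> (\<lambda>x. inv x) ` S \<and>
    word_element p \<otimes> s \<noteq> word_element (butlast p)"
proof (cases p rule: rev_cases)
  case Nil
  then show ?thesis
    using one_notin_S S_subset by (auto simp: legal_moves_def word_element_def)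
next
  case (snoc q t)
  have c: "word_element q \<in> carrier G" "t \<in> carrier G"
    using assms snoc by (auto intro: word_element_closed)
  have eq: "word_element q \<otimes> t \<otimes> s = word_element q \<longleftrightarrow> s = inv t"
    if s: "s \<in> carrier G"
  proof -
    have "word_element q \<otimes> t \<otimes> s = word_element q \<longleftrightarrow> t \<otimes> s = \<one>"
      using c s by (simp add: m_assoc)
    also have "\<dots> \<longleftrightarrow> s = inv t"
      using c s inv_equality[of t s] by auto
    finally show ?thesis .
  qed
  note * = eq[OF moves_closed]
  show ?thesis
    unfolding legal_moves_def snoc butlast_snoc word_element_snoc mem_Collect_eq last_snoc
    by (rule conj_cong) (simp_all add: * del: Un_iff)
qed

text \<open>The translation from letters to vertices: the ban on cancelling the last letter becomes
  the ban on stepping back to the previous vertex.\<close>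

lemma adjacent_iff_move:
  assumes "set p \<subseteq> carrier G"
  shows "adjacent (word_element p) y \<and> y \<noteq> word_element (butlast p) \<longleftrightarrow>
    (\<exists>s \<in> legal_moves p. y = word_element (p @ [s]))"
  using legal_moves_iff[OF assms] word_element_closed[OF assms]
  by (auto simp: adjacent_def word_element_snoc)

text \<open>Player 2 always moves to a vertex that closes a relator or satisfies
  \<open>second_wins\<close> again. At the start \<open>\<one>\<close> serves as its own
  predecessor, matching \<open>butlast [] = []\<close>.\<close>

lemma has_winning_strategy_if_second_wins:
  assumes "second_wins adjacent {\<one>} \<one> \<one>"
  shows "has_winning_strategy Player2"
proof -
  define W where "W p \<longleftrightarrow> second_wins adjacent (visited p) (word_element (butlast p)) (word_element p)" for p
  define good where "good p s \<longleftrightarrow> s \<in> legal_moves p \<and> (relator_formed (p @ [s]) \<or> W (p @ [s]))" for p s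
  \<comment> \<open>A strategy must be legal at every unfinished position, also at those it never
    reaches; hence the fallback to any legal letter when no good one exists.\<close>
  define \<sigma> where "\<sigma> p = (SOME s. s \<in> legal_moves p \<and> ((\<exists>s. good p s) \<longrightarrow> good p s))" for p
  have \<sigma>: "\<sigma> p \<in> legal_moves p \<and> ((\<exists>s. good p s) \<longrightarrow> good p (\<sigma> p))" if "legal_moves p \<noteq> {}" for p
  proof -
    have "\<exists>s. s \<in> legal_moves p \<and> ((\<exists>s. good p s) \<longrightarrow> good p s)"
      using that unfolding good_def by blast
    then show ?thesis unfolding \<sigma>_def by (rule someI_ex)
  qed
  have step: "\<not> relator_formed (p @ [s]) \<and> (\<exists>t. good (p @ [s]) t)"
    if "W p" "s \<in> legal_moves p" "set p \<subseteq> carrier G" for p s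
  proof -
    have c: "set (p @ [s]) \<subseteq> carrier G"
      using that legal_moves_closed[of p] by auto
    let ?y = "word_element (p @ [s])"
    have "adjacent (word_element p) ?y \<and> ?y \<noteq> word_element (butlast p)"
      unfolding adjacent_iff_move[OF that(3)] using that(2) by blast
    with that(1) obtain z where y: "?y \<notin> visited p" and z: "adjacent ?y z" "z \<noteq> word_element p"
      and zw: "z \<in> visited p \<or> second_wins adjacent (insert z (insert ?y (visited p))) ?y z"
      unfolding W_def by (auto elim: second_wins.cases)
    obtain t where t: "t \<in> legal_moves (p @ [s])" "z = word_element ((p @ [s]) @ [t])"
      using adjacent_iff_move[OF c, of z] z by auto
    have "good (p @ [s]) t"
      unfolding good_def W_def relator_formed_snoc visited_snoc[of _ t] visited_snoc[of p s] t(2)[symmetric] butlast_snoc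
      using t(1) zw by auto
    then show ?thesis using y unfolding relator_formed_snoc by blast
  qed
  \<comment> \<open>The invariant along plays following \<open>\<sigma>\<close>: at even length
    \<open>W\<close> holds or Player 2 has just closed a relator; at odd length Player 1 has closed
    none and a good reply exists.\<close>
  have main: "if even (length p) then W p \<or> relator_formed p
      else \<not> relator_formed p \<and> (\<exists>t. good p t)"
    if "position p" "follows Player2 \<sigma> p" for p
    using that
  proof (induction rule: position.induct)
    case start
    show ?case using assms by (simp add: W_def visited_Nil word_element_def)
  next
    case (move p s)
    have fol: "follows Player2 \<sigma> p" and fs: "to_move p = Player2 \<longrightarrow> s = \<sigma> p"
      using move.prems unfolding follows_def
      by (auto simp: nth_append) (metis less_Suc_eq less_imp_le_nat nth_append diff_is_0_eq take0 append_Nil2)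
    note IH = move.IH[OF fol]
    have nr: "\<not> relator_formed p" using move.hyps by (simp add: finished_def)
    show ?case
    proof (cases "even (length p)")
      case True
      then have "W p" using IH nr by simp
      from step[OF this move.hyps(3) position_closed[OF move.hyps(1)]] True show ?thesis by simp
    next
      case False
      then have "s = \<sigma> p" using fs by (simp add: to_move_def)
      moreover have "\<exists>t. good p t" using IH False by simp
      ultimately have "good p s" using \<sigma>[of p] move.hyps(3) by auto
      then show ?thesis using False by (auto simp: good_def)
    qed
  qed
  have "winning_strategy Player2 \<sigma>"
    unfolding winning_strategy_def
  proof (intro conjI allI impI)
    show "strategy Player2 \<sigma>"
      using \<sigma> by (auto simp: strategy_def finished_def)
  next
    fix p assume p: "position p \<and> finished p \<and> follows Player2 \<sigma> p"
    with main[of p] have m: "if even (length p) then W p \<or> relator_formed p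
      else \<not> relator_formed p \<and> (\<exists>t. good p t)" by simp
    show "wins Player2 p"
    proof (cases "even (length p)")
      case True
      show ?thesis
      proof (cases "relator_formed p")
        case rel: True
        then have "p \<noteq> []" by (auto simp: relator_formed_def)
        then have "odd (length (butlast p))" using True by simp
        then show ?thesis using rel by (simp add: wins_def to_move_def)
      next
        case False
        then show ?thesis using p True by (simp add: wins_def finished_def to_move_def)
      qed
    next
      case False
      then show ?thesis using m p by (auto simp: good_def finished_def)
    qed
  qed
  then show ?thesis unfolding has_winning_strategy_def by blast
qed

end

section \<open>The walk game on an abstract dicyclic Cayley graph\<close>

text \<open>
  In the Cayley graph of the dicyclic group, \<open>f i\<close> is \<open>a\<^sup>i\<close> and \<open>col i\<close> is \<open>{a\<^sup>i b, a\<^sup>i\<^sup>+\<^sup>n b}\<close>, a coset of the centre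
  \<open>\<langle>a\<^sup>n\<rangle>\<close>. This description is invariant under the automorphism inverting \<open>a\<close> and exchanging
  \<open>b\<close> with \<open>c\<close>.
\<close>

locale dicyclic_graph =
  fixes adj :: "'a \<Rightarrow> 'a \<Rightarrow> bool" and n :: int and f :: "int \<Rightarrow> 'a" and col :: "int \<Rightarrow> 'a set"
  assumes n_even: "even n" and n_ge: "n \<ge> 2"
    and f_eq: "f i = f j \<longleftrightarrow> 2 * n dvd i - j"
    and f_notin_col: "f i \<notin> col c"
    and col_eq: "n dvd c - d \<Longrightarrow> col c = col d"
    and col_disjoint: "\<not> n dvd c - d \<Longrightarrow> col c \<inter> col d = {}"
    and adj_f: "adj (f i) y \<longleftrightarrow> y = f (i + 1) \<or> y = f (i - 1) \<or> y \<in> col i \<or> y \<in> col (i + 1)"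
    and adj_sym: "adj x y \<Longrightarrow> adj y x"
begin

lemma f_inj: "0 \<le> i \<Longrightarrow> i < 2 * n \<Longrightarrow> 0 \<le> j \<Longrightarrow> j < 2 * n \<Longrightarrow> f i = f j \<longleftrightarrow> i = j"
  unfolding f_eq using zdvd_imp_le[of "2 * n" "i - j"] zdvd_imp_le[of "2 * n" "j - i"]
  by (cases i j rule: linorder_cases) (auto simp: dvd_diff_commute)

lemma f_mem_image: "A \<subseteq> {0..<2 * n} \<Longrightarrow> 0 \<le> i \<Longrightarrow> i < 2 * n \<Longrightarrow> f i \<in> f ` A \<longleftrightarrow> i \<in> A"
  using f_inj by (auto simp: image_iff subset_iff)

lemma col_not_dvd: "y \<in> col c \<Longrightarrow> y \<in> col d \<Longrightarrow> n dvd c - d"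
  using col_disjoint by blast

lemma not_n_dvd: "0 < d \<Longrightarrow> d < n \<Longrightarrow> \<not> n dvd d"
  by (auto dest: zdvd_imp_le)

lemma col_distinct: "y \<in> col c \<Longrightarrow> z \<in> col d \<Longrightarrow> 0 < c - d \<Longrightarrow> c - d < n \<Longrightarrow> y \<noteq> z"
  using col_not_dvd not_n_dvd by blast

lemma col_shift: "col (c + n) = col c" "col (c - n) = col c"
  by (rule col_eq; simp)+

text \<open>Both shifts by \<open>n\<close> are listed, although
  \<open>f (c + n) = f (c - n)\<close>, so that an index between \<open>0\<close> and
  \<open>2 * n\<close> is at hand in each use.\<close>

lemma adj_col:
  assumes "y \<in> col c"
  shows "adj y (f c)" "adj y (f (c - 1))" "adj y (f (c + n))" "adj y (f (c + n - 1))"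
    "adj y (f (c - n))" "adj y (f (c - n - 1))"
  using assms col_shift[of c]
  by (auto intro!: adj_sym[of "f _" y] simp: adj_f)

lemma adj_f_succ: "adj (f i) (f (i + 1))" "adj (f i) (f (i - 1))"
  by (simp_all add: adj_f)

text \<open>
  The first arc runs upwards from \<open>0\<close> to \<open>k\<close>; the crossing at \<open>k\<close> through \<open>w\<close> forces the next one to run
  downwards from \<open>k + n\<close> to \<open>m\<close>, and the crossing at \<open>m\<close> through \<open>w'\<close> forces the last one to run
  upwards from \<open>m + n\<close> to \<open>l\<close>.
\<close>

lemma wins_three_arcs:
  assumes "w \<in> col (k + 1)" "w' \<in> col m" "0 \<le> k" "k + 2 \<le> m" "m \<le> n - 2" "even m"
    and "m + n \<le> l" "l \<le> 2 * n - 2" "even l"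
    and "u = (if l = m + n then w' else f (l - 1))"
  shows "second_wins adj (insert w' (insert w (f ` ({0..k} \<union> {m..k + n} \<union> {m + n..l})))) u (f l)"
  using assms(7-)
proof (induction "nat (2 * n - l)" arbitrary: l u rule: less_induct)
  case less
  let ?A = "{0..k} \<union> {m..k + n} \<union> {m + n..l}"
  let ?V = "insert w' (insert w (f ` ?A))"
  have A: "?A \<subseteq> {0..<2 * n}" using assms less.prems by auto
  have fw: "f i \<noteq> w" "f i \<noteq> w'" for i using f_notin_col assms by metis+
  have mem: "f i \<in> ?V \<longleftrightarrow> i \<in> ?A" if "0 \<le> i" "i < 2 * n" for i
    using f_mem_image[OF A that] fw by auto
  show ?case
  proof (rule second_winsI)
    fix y assume y: "adj (f l) y" "y \<noteq> u"
    consider (up) "y = f (l + 1)" | (down) "y = f (l - 1)" | (c0) "y \<in> col l" | (c1) "y \<in> col (l + 1)"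
      using y adj_f by blast
    then show "y \<notin> ?V \<and> (\<exists>z. adj y z \<and> z \<noteq> f l \<and> (z \<in> ?V \<or> second_wins adj (insert z (insert y ?V)) y z))"
    proof cases
      case up
      have 1: "y \<notin> ?V" unfolding up using mem[of "l + 1"] less.prems assms by simp
      show ?thesis
      proof (cases "l = 2 * n - 2")
        case True
        \<comment> \<open>Here \<open>y = f (2 * n - 1)\<close>, and one more step up wraps around
          to \<open>f (2 * n) = f 0\<close>.\<close>
        have "adj y (f 0)" using adj_f_succ(1)[of "l + 1"] f_eq[of "l + 1 + 1" 0] True up by simp
        moreover have "f 0 \<noteq> f l" using f_inj[of 0 l] less.prems assms by auto
        moreover have "f 0 \<in> ?V" using assms by auto
        ultimately show ?thesis using 1 by blast
      next
        case False
        have l: "l + 2 \<le> 2 * n - 2" using False less.prems(2,3) by presburger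
        have V: "insert (f (l + 2)) (insert y ?V)
            = insert w' (insert w (f ` ({0..k} \<union> {m..k + n} \<union> {m + n..l + 2})))"
        proof -
          have "{m + n..l + 2} = insert (l + 2) (insert (l + 1) {m + n..l})" using less.prems by auto
          then show ?thesis unfolding up by auto
        qed
        have "second_wins adj (insert (f (l + 2)) (insert y ?V)) y (f (l + 2))"
          unfolding V by (rule less.hyps) (use l less.prems up in \<open>auto simp: algebra_simps\<close>)
        moreover have "adj y (f (l + 2))" using adj_f_succ(1)[of "l + 1"] up by (simp add: algebra_simps)
        moreover have "f (l + 2) \<noteq> f l" using f_inj[of "l + 2" l] less.prems assms l by auto
        ultimately show ?thesis using 1 by blast
      qed
    next
      case down
      then have l: "l = m + n" using y less.prems by (simp split: if_splits)
      have 1: "y \<notin> ?V" unfolding down using mem[of "l - 1"] less.prems assms l by simp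
      \<comment> \<open>The middle vertex \<open>w'\<close> is adjacent to \<open>f (m + n)\<close>
        and to \<open>f (m + n - 1)\<close>, so after a step down Player 2 can return to it.\<close>
      have "adj w' y" using adj_col(4)[OF assms(2)] by (simp add: down l)
      then show ?thesis using 1 fw adj_sym by blast
    next
      case c0
      have "y \<noteq> w'"
      proof (cases "l = m + n")
        case True then show ?thesis using y less.prems by simp
      next
        case False
        have "w' \<in> col (m + n)" using assms col_shift by simp
        from col_distinct[OF c0 this] show ?thesis using False less.prems assms by simp
      qed
      moreover have "y \<noteq> w"
        using col_distinct[of y "l - n" w "k + 1"] c0 assms less.prems col_shift by simp
      moreover have "y \<noteq> f i" for i using f_notin_col c0 by metis
      ultimately have 1: "y \<notin> ?V" by auto
      \<comment> \<open>Since \<open>m \<le> l - n \<le> n - 2\<close>, the vertex opposite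
        \<open>f l\<close> already lies on the middle arc.\<close>
      moreover have "adj y (f (l - n))" using adj_col[OF c0] by blast
      moreover have "f (l - n) \<noteq> f l" using f_inj[of "l - n" l] less.prems assms by auto
      moreover have "f (l - n) \<in> ?V" using mem[of "l - n"] less.prems assms by simp
      ultimately show ?thesis by blast
    next
      case c1
      have "y \<noteq> w'"
        using col_distinct[of y "l + 1 - n" w' m] c1 assms less.prems col_shift by simp
      moreover have "y \<noteq> w"
        using col_distinct[of y "l + 1 - n" w "k + 1"] c1 assms less.prems col_shift by simp
      moreover have "y \<noteq> f i" for i using f_notin_col c1 by metis
      ultimately have 1: "y \<notin> ?V" by auto
      moreover have "adj y (f (l + 1 - n))" using adj_col[OF c1] by blast
      moreover have "f (l + 1 - n) \<noteq> f l" using f_inj[of "l + 1 - n" l] less.prems assms by auto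
      moreover have "f (l + 1 - n) \<in> ?V" using mem[of "l + 1 - n"] less.prems assms by simp
      ultimately show ?thesis by blast
    qed
  qed
qed

text \<open>Induction on \<open>m\<close>: every step down is repeated. As \<open>k\<close> and
  \<open>m\<close> are both even, it is Player 1 who must enter the last gap
  \<open>f (k + 1)\<close>, and Player 2 closes at \<open>f k\<close>. A second crossing below
  \<open>n\<close> leads to \<open>wins_three_arcs\<close>.\<close>

lemma wins_two_arcs:
  assumes "w \<in> col (k + 1)" "0 \<le> k" "k \<le> n - 2" "even k"
    and "k + 2 \<le> m" "m \<le> k + n" "even m"
    and "u = (if m = k + n then w else f (m + 1))"
  shows "second_wins adj (insert w (f ` ({0..k} \<union> {m..k + n}))) u (f m)"
  using assms(5-)
proof (induction "nat m" arbitrary: m u rule: less_induct)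
  case less
  let ?A = "{0..k} \<union> {m..k + n}"
  let ?V = "insert w (f ` ?A)"
  have A: "?A \<subseteq> {0..<2 * n}" using assms less.prems by auto
  have fw: "f i \<noteq> w" for i using f_notin_col assms by metis
  have mem: "f i \<in> ?V \<longleftrightarrow> i \<in> ?A" if "0 \<le> i" "i < 2 * n" for i
    using f_mem_image[OF A that] fw by auto
  show ?case
  proof (rule second_winsI)
    fix y assume y: "adj (f m) y" "y \<noteq> u"
    consider (up) "y = f (m + 1)" | (down) "y = f (m - 1)" | (c0) "y \<in> col m" | (c1) "y \<in> col (m + 1)"
      using y adj_f by blast
    then show "y \<notin> ?V \<and> (\<exists>z. adj y z \<and> z \<noteq> f m \<and> (z \<in> ?V \<or> second_wins adj (insert z (insert y ?V)) y z))"
    proof cases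
      case up
      then have m: "m = k + n" using y less.prems by (simp split: if_splits)
      have 1: "y \<notin> ?V" unfolding up using mem[of "m + 1"] less.prems assms m by simp
      \<comment> \<open>\<open>w\<close> is adjacent to both \<open>f (k + n)\<close> and
        \<open>f (k + n + 1)\<close>, which punishes turning upwards just after the
        crossing.\<close>
      have "adj w y" using adj_col(3)[OF assms(1)] by (simp add: up m algebra_simps)
      then show ?thesis using 1 fw adj_sym by blast
    next
      case down
      have 1: "y \<notin> ?V" unfolding down using mem[of "m - 1"] less.prems assms by simp
      show ?thesis
      proof (cases "m = k + 2")
        case True
        have "adj y (f k)" using adj_f_succ(2)[of "m - 1"] True down by simp
        moreover have "f k \<noteq> f m" using f_inj[of k m] less.prems assms by auto
        moreover have "f k \<in> ?V" using assms by auto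
        ultimately show ?thesis using 1 by blast
      next
        case False
        have m: "k + 2 \<le> m - 2" using False less.prems(1,3) assms(4) by presburger
        have V: "insert (f (m - 2)) (insert y ?V) = insert w (f ` ({0..k} \<union> {m - 2..k + n}))"
        proof -
          have "{m - 2..k + n} = insert (m - 2) (insert (m - 1) {m..k + n})" using less.prems by auto
          then show ?thesis unfolding down by auto
        qed
        have "second_wins adj (insert (f (m - 2)) (insert y ?V)) y (f (m - 2))"
          unfolding V by (rule less.hyps) (use m less.prems down assms in \<open>auto simp: algebra_simps\<close>)
        moreover have "adj y (f (m - 2))" using adj_f_succ(2)[of "m - 1"] down by (simp add: algebra_simps)
        moreover have "f (m - 2) \<noteq> f m" using f_inj[of "m - 2" m] less.prems assms m by auto
        ultimately show ?thesis using 1 by blast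
      qed
    next
      case c0
      have yf: "y \<noteq> f i" for i using f_notin_col c0 by metis
      show ?thesis
      proof (cases "m < n")
        case True
        \<comment> \<open>By parity \<open>m = n - 1\<close> is impossible, so
          \<open>f (m + n)\<close> can start the third arc, with \<open>y\<close> as the middle
          vertex of the crossing.\<close>
        have m: "m \<le> n - 2" using True less.prems(3) n_even by presburger
        have "y \<noteq> w" using col_distinct[OF c0 assms(1)] less.prems m assms by simp
        then have 1: "y \<notin> ?V" using yf by auto
        have V: "insert (f (m + n)) (insert y ?V)
            = insert y (insert w (f ` ({0..k} \<union> {m..k + n} \<union> {m + n..m + n})))"
          by auto
        have "second_wins adj (insert (f (m + n)) (insert y ?V)) y (f (m + n))"
          unfolding V by (rule wins_three_arcs) (use assms less.prems m c0 n_even in auto)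
        moreover have "adj y (f (m + n))" using adj_col[OF c0] by blast
        moreover have "f (m + n) \<noteq> f m" using f_inj[of "m + n" m] less.prems assms m by auto
        ultimately show ?thesis using 1 by blast
      next
        case False
        have "y \<noteq> w"
          using col_distinct[of w "k + 1" y "m - n"] c0 assms less.prems col_shift False by auto
        then have "y \<notin> ?V" using yf by auto
        \<comment> \<open>Now \<open>0 \<le> m - n \<le> k\<close>, so the reply lands on the first
          arc.\<close>
        moreover have "adj y (f (m - n))" using adj_col[OF c0] by blast
        moreover have "f (m - n) \<noteq> f m" using f_inj[of "m - n" m] less.prems assms False by auto
        moreover have "f (m - n) \<in> ?V" using mem[of "m - n"] less.prems assms False by simp
        ultimately show ?thesis by blast
      qed
    next
      case c1
      have yf: "y \<noteq> f i" for i using f_notin_col c1 by metis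
      show ?thesis
      proof (cases "m = k + n")
        case True
        \<comment> \<open>Here \<open>col (m + 1) = col (k + 1)\<close> contains \<open>w\<close>,
          but \<open>w\<close> is the predecessor \<open>u\<close>, so \<open>y\<close> is a
          different vertex; like \<open>w\<close> it is adjacent to \<open>f k\<close>.\<close>
        then have "y \<notin> ?V" using yf y less.prems by auto
        moreover have "adj y (f k)" using adj_col(6)[OF c1] True by simp
        moreover have "f k \<noteq> f m" using f_inj[of k m] less.prems assms by auto
        moreover have "f k \<in> ?V" using assms by auto
        ultimately show ?thesis by blast
      next
        case False
        have "y \<noteq> w" using col_distinct[OF c1 assms(1)] less.prems False by simp
        then have "y \<notin> ?V" using yf by auto
        \<comment> \<open>\<open>y\<close> forms a triangle with \<open>f m\<close> and the visited
          vertex \<open>f (m + 1)\<close>.\<close>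
        moreover have "adj y (f (m + 1))" using adj_col[OF c1] by blast
        moreover have "f (m + 1) \<noteq> f m" using f_inj[of "m + 1" m] less.prems assms by auto
        moreover have "f (m + 1) \<in> ?V" using mem[of "m + 1"] less.prems assms False by simp
        ultimately show ?thesis by blast
      qed
    qed
  qed
qed

text \<open>The case \<open>k = 0\<close> is an opening move. For \<open>k < n\<close> the opposite
  vertex \<open>f (k + n)\<close> is still free and starts the downward arc; for
  \<open>k \<ge> n\<close> the first arc has already reached round to a second neighbour of
  \<open>y\<close>.\<close>

lemma crossing_reply:
  assumes y: "y \<in> col (k + 1)" and k: "0 \<le> k" "k \<le> 2 * n - 2" "even k"
  shows "y \<notin> f ` {0..k} \<and> (\<exists>z. adj y z \<and> z \<noteq> f k \<and>
    (z \<in> f ` {0..k} \<or> second_wins adj (insert z (insert y (f ` {0..k}))) y z))"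
proof -
  have 1: "y \<notin> f ` {0..k}" using f_notin_col y by blast
  show ?thesis
  proof (cases "k < n")
    case True
    then have k': "k \<le> n - 2" using k n_even by presburger
    have V: "insert (f (k + n)) (insert y (f ` {0..k})) = insert y (f ` ({0..k} \<union> {k + n..k + n}))"
      by auto
    have "second_wins adj (insert (f (k + n)) (insert y (f ` {0..k}))) y (f (k + n))"
      unfolding V by (rule wins_two_arcs) (use y k k' n_even n_ge in auto)
    moreover have "adj y (f (k + n))" using adj_col(4)[OF y] by (simp add: algebra_simps)
    moreover have "f (k + n) \<noteq> f k" using f_inj[of "k + n" k] k k' n_ge by auto
    ultimately show ?thesis using 1 by blast
  next
    case False
    have "adj y (f (k + 1 - n))" using adj_col[OF y] by blast
    moreover have "f (k + 1 - n) \<noteq> f k" using f_inj[of "k + 1 - n" k] k False n_ge by auto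
    moreover have "f (k + 1 - n) \<in> f ` {0..k}" using k False n_ge by auto
    ultimately show ?thesis using 1 by blast
  qed
qed

text \<open>A step up is repeated until the cycle closes at \<open>f (2 * n) = f 0\<close>; a vertex
  of \<open>col k\<close> forms a triangle with \<open>f k\<close> and \<open>f (k - 1)\<close>; a
  vertex of \<open>col (k + 1)\<close> is a crossing.\<close>

lemma wins_one_arc:
  assumes "2 \<le> k" "k \<le> 2 * n - 2" "even k"
  shows "second_wins adj (f ` {0..k}) (f (k - 1)) (f k)"
  using assms
proof (induction "nat (2 * n - k)" arbitrary: k rule: less_induct)
  case less
  let ?V = "f ` {0..k}"
  have A: "{0..k} \<subseteq> {0..<2 * n}" using less.prems by auto
  note mem = f_mem_image[OF A]
  show ?case
  proof (rule second_winsI)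
    fix y assume y: "adj (f k) y" "y \<noteq> f (k - 1)"
    consider (up) "y = f (k + 1)" | (c0) "y \<in> col k" | (c1) "y \<in> col (k + 1)"
      using y adj_f by blast
    then show "y \<notin> ?V \<and> (\<exists>z. adj y z \<and> z \<noteq> f k \<and> (z \<in> ?V \<or> second_wins adj (insert z (insert y ?V)) y z))"
    proof cases
      case up
      have 1: "y \<notin> ?V" unfolding up using mem[of "k + 1"] less.prems by simp
      show ?thesis
      proof (cases "k = 2 * n - 2")
        case True
        have "adj y (f 0)" using adj_f_succ(1)[of "k + 1"] f_eq[of "k + 1 + 1" 0] True up by simp
        moreover have "f 0 \<noteq> f k" using f_inj[of 0 k] less.prems by auto
        moreover have "f 0 \<in> ?V" using less.prems by auto
        ultimately show ?thesis using 1 by blast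
      next
        case False
        have k: "k + 2 \<le> 2 * n - 2" using False less.prems by presburger
        have V: "insert (f (k + 2)) (insert y ?V) = f ` {0..k + 2}"
        proof -
          have "{0..k + 2} = insert (k + 2) (insert (k + 1) {0..k})" using less.prems by auto
          then show ?thesis unfolding up by simp
        qed
        have pred: "k + 2 - 1 = k + 1" by simp
        have "second_wins adj (f ` {0..k + 2}) (f (k + 2 - 1)) (f (k + 2))"
          by (rule less.hyps) (use k less.prems in auto)
        then have "second_wins adj (insert (f (k + 2)) (insert y ?V)) y (f (k + 2))"
          using V up pred by metis
        moreover have "adj y (f (k + 2))" using adj_f_succ(1)[of "k + 1"] up by (simp add: algebra_simps)
        moreover have "f (k + 2) \<noteq> f k" using f_inj[of "k + 2" k] less.prems k by auto
        ultimately show ?thesis using 1 by blast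
      qed
    next
      case c0
      have "y \<notin> ?V" using f_notin_col c0 by blast
      moreover have "adj y (f (k - 1))" using adj_col[OF c0] by blast
      moreover have "f (k - 1) \<noteq> f k" using f_inj[of "k - 1" k] less.prems by auto
      moreover have "f (k - 1) \<in> ?V" using less.prems by auto
      ultimately show ?thesis by blast
    next
      case c1
      show ?thesis by (rule crossing_reply[OF c1]) (use less.prems in auto)
    qed
  qed
qed

lemma opening_reply:
  assumes "y = f 1 \<or> y \<in> col 1"
  shows "y \<notin> {f 0} \<and> (\<exists>z. adj y z \<and> z \<noteq> f 0 \<and>
    (z \<in> {f 0} \<or> second_wins adj (insert z (insert y {f 0})) y z))"
  using assms
proof
  assume y: "y = f 1"
  have V: "insert (f 2) (insert y {f 0}) = f ` {0..2}"
  proof -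
    have "{0..2::int} = {2, 1, 0}" by auto
    then show ?thesis by (simp add: y)
  qed
  have "second_wins adj (insert (f 2) (insert y {f 0})) y (f 2)"
    unfolding V unfolding y using wins_one_arc[of 2] n_ge by simp
  moreover have "adj y (f 2)" using adj_f_succ(1)[of 1] y by simp
  moreover have "f 2 \<noteq> f 0" "y \<notin> {f 0}" using f_inj[of 2 0] f_inj[of 1 0] n_ge y by auto
  ultimately show ?thesis by blast
next
  assume "y \<in> col 1"
  then show ?thesis using crossing_reply[of y 0] n_ge by simp
qed

text \<open>Reflecting \<open>i\<close> to \<open>- i\<close> sends the columns \<open>i\<close> and
  \<open>i + 1\<close> next to \<open>f i\<close> to \<open>1 - i\<close> and \<open>- i\<close>,
  the ones next to \<open>f (- i)\<close>. This reduces the openings into \<open>f (- 1)\<close> and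
  \<open>col 0\<close> to those into \<open>f 1\<close> and \<open>col 1\<close>.\<close>

lemma mirror: "dicyclic_graph adj n (\<lambda>i. f (- i)) (\<lambda>c. col (1 - c))"
proof
  show "f (- i) = f (- j) \<longleftrightarrow> 2 * n dvd i - j" for i j
    unfolding f_eq by (simp add: dvd_diff_commute)
  show "adj (f (- i)) y \<longleftrightarrow> y = f (- (i + 1)) \<or> y = f (- (i - 1)) \<or> y \<in> col (1 - i) \<or> y \<in> col (1 - (i + 1))"
    for i y
  proof -
    have "- (i + 1) = - i - 1" "- (i - 1) = - i + 1" "1 - i = - i + 1" "1 - (i + 1) = - i" by simp_all
    then show ?thesis using adj_f[of "- i" y] by metis
  qed
  show "n dvd c - d \<Longrightarrow> col (1 - c) = col (1 - d)" for c d
    by (rule col_eq) (simp add: dvd_diff_commute)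
  show "\<not> n dvd c - d \<Longrightarrow> col (1 - c) \<inter> col (1 - d) = {}" for c d
    by (rule col_disjoint) (simp add: dvd_diff_commute)
qed (use n_even n_ge f_notin_col adj_sym in auto)

lemma second_wins_start: "second_wins adj {f 0} (f 0) (f 0)"
proof (rule second_winsI)
  fix y assume "adj (f 0) y"
  then consider "y = f 1 \<or> y \<in> col 1" | "y = f (- 1) \<or> y \<in> col 0"
    using adj_f[of 0 y] by auto
  then show "y \<notin> {f 0} \<and> (\<exists>z. adj y z \<and> z \<noteq> f 0 \<and>
      (z \<in> {f 0} \<or> second_wins adj (insert z (insert y {f 0})) y z))"
  proof cases
    case 1
    then show ?thesis by (rule opening_reply)
  next
    case 2
    then show ?thesis using dicyclic_graph.opening_reply[OF mirror, of y] by simp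
  qed
qed

end

section \<open>The Cayley graph of a dicyclic group\<close>

text \<open>The relations give c = ab, aba = b and b^-1 = a^n b. Hence from a^i the letters b and
  b^-1 lead to the column of index i, and c and c^-1 to that of index i + 1.\<close>

lemma (in rel_game) dicyclic_graph_adjacent:
  fixes n :: nat
  assumes n: "even n" "n \<ge> 2" and S: "S = {a, b, c}"
    and ab: "a [^] n = b \<otimes> b" and bc: "b \<otimes> b = c \<otimes> c" and ca: "c \<otimes> c = a \<otimes> b \<otimes> c"
    and ord: "ord a = 2 * n" and b: "\<And>i :: int. a [^] i \<noteq> b"
  shows "dicyclic_graph adjacent (int n) (\<lambda>i. a [^] i) (\<lambda>i. {a [^] i \<otimes> b, a [^] (i + int n) \<otimes> b})"
proof
  have abc: "a \<in> carrier G" "b \<in> carrier G" "c \<in> carrier G"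
    using S_subset by (auto simp: S)
  have c: "c = a \<otimes> b"
    using ca abc by (metis m_closed right_cancel)
  have "b \<otimes> b = a \<otimes> b \<otimes> a \<otimes> b"
    using bc abc by (simp add: c m_assoc)
  then have aba: "a \<otimes> b \<otimes> a = b"
    using abc by (metis m_closed right_cancel)
  have bai: "b \<otimes> inv a = a \<otimes> b"
    using aba abc by (metis inv_solve_right' m_closed)
  have pow_eq: "a [^] i = a [^] j \<longleftrightarrow> 2 * int n dvd i - j" for i j :: int
    using int_pow_eq[OF abc(1), of i j] by (simp add: ord dvd_diff_commute)
  have pow_add: "a [^] i \<otimes> a [^] j = a [^] (i + j)" for i j :: int
    using abc by (simp add: int_pow_mult)
  have inv_b: "inv b = a [^] int n \<otimes> b"
  proof (rule inv_equality)
    have "a [^] int n \<otimes> b \<otimes> b = a [^] int n \<otimes> a [^] int n"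
      using abc by (simp add: m_assoc ab int_pow_int)
    also have "\<dots> = \<one>"
      using pow_eq[of "int n + int n" 0] by (simp add: pow_add)
    finally show "a [^] int n \<otimes> b \<otimes> b = \<one>" .
  qed (use abc in auto)
  have inv_c: "inv c = a [^] (int n + 1) \<otimes> b"
    using abc by (simp add: c inv_mult_group inv_b m_assoc bai int_pow_mult)
  have mul: "a [^] i \<otimes> a = a [^] (i + 1)" "a [^] i \<otimes> inv a = a [^] (i - 1)"
    "a [^] i \<otimes> c = a [^] (i + 1) \<otimes> b" "a [^] i \<otimes> inv b = a [^] (i + int n) \<otimes> b"
    "a [^] i \<otimes> inv c = a [^] (i + 1 + int n) \<otimes> b" for i :: int
  proof -
    have pow_b: "a [^] i \<otimes> (a [^] j \<otimes> b) = a [^] (i + j) \<otimes> b" for j :: int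
      using abc pow_add[of i j] by (simp flip: m_assoc)
    show "a [^] i \<otimes> a = a [^] (i + 1)" "a [^] i \<otimes> inv a = a [^] (i - 1)"
      using abc by (simp_all add: int_pow_mult int_pow_diff)
    show "a [^] i \<otimes> c = a [^] (i + 1) \<otimes> b"
      using abc pow_b[of 1] by (simp add: c)
    show "a [^] i \<otimes> inv b = a [^] (i + int n) \<otimes> b"
      unfolding inv_b by (rule pow_b)
    show "a [^] i \<otimes> inv c = a [^] (i + 1 + int n) \<otimes> b"
      unfolding inv_c pow_b by (simp add: add_ac)
  qed
  show "adjacent (a [^] i) y \<longleftrightarrow> y = a [^] (i + 1) \<or> y = a [^] (i - 1) \<or>
      y \<in> {a [^] i \<otimes> b, a [^] (i + int n) \<otimes> b} \<or>
      y \<in> {a [^] (i + 1) \<otimes> b, a [^] (i + 1 + int n) \<otimes> b}" for i y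
    unfolding adjacent_def unfolding S using abc mul[of i] by auto
  show "a [^] i = a [^] j \<longleftrightarrow> 2 * int n dvd i - j" for i j :: int
    by (rule pow_eq)
  show "a [^] i \<notin> {a [^] j \<otimes> b, a [^] (j + int n) \<otimes> b}" for i j :: int
  proof -
    have "a [^] i \<noteq> a [^] k \<otimes> b" for k :: int
    proof
      assume "a [^] i = a [^] k \<otimes> b"
      then have "a [^] (- k) \<otimes> a [^] i = a [^] (- k) \<otimes> a [^] k \<otimes> b"
        using abc by (simp add: m_assoc)
      then show False using abc b[of "- k + i"] by (simp add: pow_add)
    qed
    then show ?thesis by simp
  qed
  have coset_eq: "a [^] i \<otimes> b = a [^] j \<otimes> b \<longleftrightarrow> 2 * int n dvd i - j" for i j :: int
    using abc pow_eq by simp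
  show "{a [^] i \<otimes> b, a [^] (i + int n) \<otimes> b} = {a [^] j \<otimes> b, a [^] (j + int n) \<otimes> b}"
    if dvd: "int n dvd i - j" for i j
  proof -
    obtain q where "i - j = int n * q" using dvd by (rule dvdE)
    then have q: "i = j + int n * q" by simp
    have "2 * int n dvd int n * r" if "even r" for r
      using that by (auto elim!: evenE)
    \<comment> \<open>For even \<open>q\<close> the two elements correspond in order; for odd
      \<open>q\<close> they are exchanged, with exponents differing by \<open>n\<close> times
      \<open>q - 1\<close> and \<open>q + 1\<close>.\<close>
    from this[of q] this[of "q - 1"] this[of "q + 1"] show ?thesis
      by (cases "even q") (auto simp: doubleton_eq_iff coset_eq q algebra_simps)
  qed
  show "{a [^] i \<otimes> b, a [^] (i + int n) \<otimes> b} \<inter> {a [^] j \<otimes> b, a [^] (j + int n) \<otimes> b} = {}"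
    if "\<not> int n dvd i - j" for i j
  proof -
    have "\<not> 2 * int n dvd i - j + int n * r" for r
      using that by (metis dvd_add_left_iff dvd_mult_right dvd_triv_left)
    \<comment> \<open>Exponents from the two cosets differ by \<open>i - j\<close> plus
      \<open>n\<close> times 0, 1 or -1.\<close>
    from this[of 0] this[of 1] this[of "-1"] show ?thesis
      by (auto simp: coset_eq algebra_simps)
  qed
  show "adjacent x y \<Longrightarrow> adjacent y x" for x y by (rule adjacent_sym)
qed (use n in auto)

section \<open>Powers of \<open>a\<close> in the presented group, and the conclusion\<close>

lemma dic_a_pow: "dic_a n [^]\<^bsub>Dic n\<^esub> k = dic_normal_form n (int k, False)"
  for k :: nat
  by (induction k)
    (simp_all add: dic_normal_form_def Dic_def dic_a_def pres_gen_def presented_group_one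
      presented_group_mult replicate_append_same del: of_nat_Suc)

text \<open>Iterating aba = b gives a^n b a^n = b; as a^n = b^2 commutes with b, a^(2n) = 1. A
  smaller order would give two states in \<open>dic_states\<close> the same normal form.\<close>

lemma ord_dic_a:
  assumes "n > 0"
  shows "group.ord (Dic n) (dic_a n) = 2 * n"
proof -
  interpret group "Dic n" by (rule dic_group)
  let ?a = "dic_a n" and ?b = "dic_b n" and ?c = "dic_c n"
  have abc: "?a \<in> carrier (Dic n)" "?b \<in> carrier (Dic n)" "?c \<in> carrier (Dic n)"
    using dic_generators_closed by auto
  have c: "?c = ?a \<otimes>\<^bsub>Dic n\<^esub> ?b"
    using dic_relations_hold(3)[of n] abc by (metis m_closed right_cancel)
  have "?b \<otimes>\<^bsub>Dic n\<^esub> ?b = ?a \<otimes>\<^bsub>Dic n\<^esub> ?b \<otimes>\<^bsub>Dic n\<^esub> ?a \<otimes>\<^bsub>Dic n\<^esub> ?b"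
    using dic_relations_hold(2)[of n] abc by (simp add: c m_assoc)
  then have aba: "?a \<otimes>\<^bsub>Dic n\<^esub> ?b \<otimes>\<^bsub>Dic n\<^esub> ?a = ?b"
    using abc by (metis m_closed right_cancel)
  have *: "?a [^]\<^bsub>Dic n\<^esub> k \<otimes>\<^bsub>Dic n\<^esub> (?b \<otimes>\<^bsub>Dic n\<^esub> ?a [^]\<^bsub>Dic n\<^esub> k) = ?b" for k :: nat
  proof (induction k)
    case (Suc k)
    have "?a [^]\<^bsub>Dic n\<^esub> Suc k \<otimes>\<^bsub>Dic n\<^esub> (?b \<otimes>\<^bsub>Dic n\<^esub> ?a [^]\<^bsub>Dic n\<^esub> Suc k)
        = ?a \<otimes>\<^bsub>Dic n\<^esub> (?a [^]\<^bsub>Dic n\<^esub> k \<otimes>\<^bsub>Dic n\<^esub> (?b \<otimes>\<^bsub>Dic n\<^esub> ?a [^]\<^bsub>Dic n\<^esub> k)) \<otimes>\<^bsub>Dic n\<^esub> ?a"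
      using abc nat_pow_Suc2[OF abc(1), of k] nat_pow_Suc[of ?a k] by (metis m_assoc m_closed nat_pow_closed)
    then show ?case by (simp add: Suc.IH aba)
  qed (use abc in simp)
  have "?a [^]\<^bsub>Dic n\<^esub> (2 * n) \<otimes>\<^bsub>Dic n\<^esub> ?b = ?b"
    using *[of n] abc nat_pow_mult[OF abc(1), of n n]
    by (metis dic_relations_hold(1) m_assoc m_closed mult_2)
  then have "?a [^]\<^bsub>Dic n\<^esub> (2 * n) = \<one>\<^bsub>Dic n\<^esub>"
    using abc by (metis l_cancel_one' r_cancel_one nat_pow_closed)
  then have dvd: "ord ?a dvd 2 * n"
    using pow_eq_id abc by blast
  then have pos: "0 < ord ?a" "ord ?a \<le> 2 * n" using assms by (auto intro: dvd_imp_le Nat.gr0I)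
  have "dic_normal_form n (int (ord ?a), False) = dic_normal_form n (int 0, False)"
    using pow_ord_eq_1[OF abc(1)] unfolding dic_a_pow[symmetric] by simp
  moreover have "(int 0, False) \<in> dic_states n" using assms by (simp add: dic_states_def)
  ultimately have "(int (ord ?a), False) \<notin> dic_states n"
    using pos(1) inj_onD[OF inj_on_dic_normal_form[OF assms], of "(int (ord ?a), False)" "(int 0, False)"]
    by auto
  then show ?thesis using pos by (simp add: dic_states_def)
qed

text \<open>Reduced modulo 2n, the power is the normal form of a state \<open>(k, False)\<close>,
  whereas \<open>b\<close> is that of \<open>(0, True)\<close>.\<close>

lemma dic_a_int_pow_neq_b:
  assumes "n > 0"
  shows "dic_a n [^]\<^bsub>Dic n\<^esub> (i :: int) \<noteq> dic_b n"
proof -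
  interpret group "Dic n" by (rule dic_group)
  have a: "dic_a n \<in> carrier (Dic n)"
    using dic_generators_closed by auto
  let ?k = "nat (i mod (2 * int n))"
  have "dic_a n [^]\<^bsub>Dic n\<^esub> i = dic_a n [^]\<^bsub>Dic n\<^esub> int ?k"
    using assms int_pow_eq[OF a, of i "int ?k"] by (simp add: ord_dic_a mod_eq_dvd_iff[symmetric])
  also have "\<dots> = dic_normal_form n (int ?k, False)"
    by (simp only: int_pow_int dic_a_pow)
  also have "\<dots> \<noteq> dic_normal_form n (0, True)"
    using assms inj_onD[OF inj_on_dic_normal_form[OF assms], of "(int ?k, False)" "(0, True)"]
    by (auto simp: dic_states_def)
  finally show ?thesis
    by (simp add: dic_normal_form_def dic_b_def pres_gen_def)
qed

theorem theorem4p6: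
  fixes n :: nat
  assumes "even n" and "n \<ge> 2"
  shows "rel_game.has_winning_strategy (Dic n) {dic_a n, dic_b n, dic_c n} Player2"
proof -
  have n: "n > 0" using assms by simp
  interpret rel_game "Dic n" "{dic_a n, dic_b n, dic_c n}" by (rule dic_rel_game[OF n])
  have "dicyclic_graph adjacent (int n) (\<lambda>i. dic_a n [^]\<^bsub>Dic n\<^esub> i)
      (\<lambda>i. {dic_a n [^]\<^bsub>Dic n\<^esub> i \<otimes>\<^bsub>Dic n\<^esub> dic_b n, dic_a n [^]\<^bsub>Dic n\<^esub> (i + int n) \<otimes>\<^bsub>Dic n\<^esub> dic_b n})"
    by (rule dicyclic_graph_adjacent[OF assms HOL.refl dic_relations_hold])
      (simp_all add: n ord_dic_a dic_a_int_pow_neq_b)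
  from dicyclic_graph.second_wins_start[OF this] show ?thesis
    using has_winning_strategy_if_second_wins by simp
qed

end
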